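(* Let $\Omega=[0,1]^d$ and let $|||\cdot|||$ be any norm on functions on $\Omega$. Suppose that there exists a function $h\in L_1(\Omega)$, not identically zero, satisfying: (1) $\int_\Omega h=0$; (2) $|||h|||<\infty$; (3) the closed sets $\overline{\{h>0\}}$ and $\overline{\{h<0\}}$ are disjoint. Then for any $p\in(1,\infty)$, $$\sup_{f,g\in\mathcal D(\Omega),\ f\ne g}\frac{W_p(f,g)}{|||f-g|||}=\infty.$$
   Context: $\mathcal D(\Omega)$ is the set of probability density functions on $\Omega$ (with respect to Lebesgue measure). $W_p(f,g)$ is the $p$-Wasserstein distance between the measures $\mu,\nu$ with densities $f,g$: $W_p^p(\mu,\nu)=\inf_\pi\int\|x-y\|^p\,d\pi(x,y)$ over couplings $\pi$ of $\mu$ and $\nu$, with $\|\cdot\|$ the Euclidean norm. The norm $|||\cdot|||$ is allowed to take the value $+\infty$ on some functions (with a quotient by $+\infty$ equal to $0$). "Not identically zero" means nonzero on a set of positive measure. *)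

theory Defs
  imports "HOL-Analysis.Analysis"
begin

definition unit_cube :: "(real ^ 'n) set" where
  "unit_cube = {x. \<forall>i. 0 \<le> x $ i \<and> x $ i \<le> 1}"

definition L1_on :: "'a::euclidean_space set \<Rightarrow> ('a \<Rightarrow> real) set" where
  "L1_on \<Omega> = {f. integrable (lebesgue_on \<Omega>) f}"

definition densities :: "'a::euclidean_space set \<Rightarrow> ('a \<Rightarrow> real) set" where
  "densities \<Omega> = {f \<in> L1_on \<Omega>. (\<forall>x\<in>\<Omega>. 0 \<le> f x) \<and> (\<integral>x. f x \<partial>lebesgue_on \<Omega>) = 1}"

(* The Borel measure on the whole space, concentrated on \<Omega>, with density f on \<Omega>.
   Since f is only Lebesgue measurable, the density is taken on the Lebesgue
   sigma-algebra and then restricted to the Borel sets. *)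
definition density_measure :: "'a::euclidean_space set \<Rightarrow> ('a \<Rightarrow> real) \<Rightarrow> 'a measure" where
  "density_measure \<Omega> f = distr (density (lebesgue_on \<Omega>) (\<lambda>x. ennreal (f x))) borel (\<lambda>x. x)"

definition couplings :: "'a::topological_space measure \<Rightarrow> 'a measure \<Rightarrow> ('a \<times> 'a) measure set" where
  "couplings \<mu> \<nu> = {\<pi>. sets \<pi> = sets (borel \<Otimes>\<^sub>M borel) \<and>
     distr \<pi> borel fst = \<mu> \<and> distr \<pi> borel snd = \<nu>}"

definition transport_cost ::
  "real \<Rightarrow> 'a::euclidean_space measure \<Rightarrow> 'a measure \<Rightarrow> ennreal" where
  "transport_cost p \<mu> \<nu> =
     (INF \<pi>\<in>couplings \<mu> \<nu>. \<integral>\<^sup>+ z. ennreal (norm (fst z - snd z) powr p) \<partial>\<pi>)"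

(* The p-th root of the optimal cost; the case distinction extends the root to
   ennreal by sending infinity to infinity. *)
definition wasserstein ::
  "real \<Rightarrow> 'a::euclidean_space measure \<Rightarrow> 'a measure \<Rightarrow> ennreal" where
  "wasserstein p \<mu> \<nu> =
     (if transport_cost p \<mu> \<nu> = \<infinity> then \<infinity>
      else ennreal (enn2real (transport_cost p \<mu> \<nu>) powr (1 / p)))"

(* Norms with values in [0, \<infinity>] on the integrable functions on \<Omega>. The first clause says
   that values outside \<Omega> are irrelevant. Functions that agree almost everywhere on \<Omega>
   may, but need not, be identified by N: definiteness is required only up to null
   sets, so that both norms on almost-everywhere classes (such as Sobolev norms) and
   norms on genuine functions (such as Hoelder norms, infinite on discontinuous
   functions) are covered. N 0 = 0 is the instance c = 0 of homogeneity, as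
   0 * infinity = 0 in ennreal. *)
definition extended_norm_on ::
  "'a::euclidean_space set \<Rightarrow> (('a \<Rightarrow> real) \<Rightarrow> ennreal) \<Rightarrow> bool" where
  "extended_norm_on \<Omega> N \<longleftrightarrow>
     (\<forall>f\<in>L1_on \<Omega>. \<forall>g\<in>L1_on \<Omega>. (\<forall>x\<in>\<Omega>. f x = g x) \<longrightarrow> N f = N g) \<and>
     (\<forall>f\<in>L1_on \<Omega>. N f = 0 \<longrightarrow> (AE x in lebesgue_on \<Omega>. f x = 0)) \<and>
     (\<forall>f\<in>L1_on \<Omega>. \<forall>c. N (\<lambda>x. c * f x) = ennreal \<bar>c\<bar> * N f) \<and>
     (\<forall>f\<in>L1_on \<Omega>. \<forall>g\<in>L1_on \<Omega>. N (\<lambda>x. f x + g x) \<le> N f + N g)"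

end

theory Submission imports Defs begin

text \<open>
  Normalise the positive part of \<open>h\<close> to a density \<open>f\<close>, and let \<open>g\<close> arise from \<open>f\<close> by replacing a
  fraction \<open>\<epsilon>\<close> of its mass by the normalised negative part. Then \<open>f - g\<close> is \<open>\<epsilon>\<close> times a fixed
  multiple of \<open>h\<close>, so its norm is linear in \<open>\<epsilon>\<close>. All of \<open>f\<close> lives on the closure of
  \<open>{h > 0}\<close>, so every coupling moves mass \<open>\<epsilon>\<close> over at least the distance \<open>\<delta> > 0\<close> between the two
  closed sets, which gives \<open>W\<^sub>p(f, g) \<ge> \<delta> \<epsilon>\<^bsup>1/p\<^esup>\<close>. The quotient is at least a constant times
  \<open>\<epsilon>\<^bsup>1/p - 1\<^esup>\<close>, which is unbounded as \<open>\<epsilon> \<rightarrow> 0\<close> because \<open>p > 1\<close>.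
\<close>

text \<open>The identity is measurable from the Lebesgue to the Borel sets, so the push-forward
  merely forgets the non-Borel sets and the usual density formula survives.\<close>

lemma emeasure_density_measure:
  assumes "f \<in> borel_measurable (lebesgue_on \<Omega>)" and "S \<in> sets borel"
  shows "emeasure (density_measure \<Omega> f) S = (\<integral>\<^sup>+x. ennreal (f x) * indicator S x \<partial>lebesgue_on \<Omega>)"
proof -
  have id: "(\<lambda>x. x) \<in> measurable (lebesgue_on \<Omega>) borel"
    by (intro measurable_restrict_space1 measurable_completion) simp
  then have "(\<lambda>x. x) -` S \<inter> space (lebesgue_on \<Omega>) \<in> sets (lebesgue_on \<Omega>)"
    using assms(2) by (rule measurable_sets)
  moreover have "emeasure (density_measure \<Omega> f) S
      = emeasure (density (lebesgue_on \<Omega>) (\<lambda>x. ennreal (f x))) (S \<inter> space (lebesgue_on \<Omega>))"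
    unfolding density_measure_def using id assms(2) by (subst emeasure_distr) auto
  ultimately show ?thesis
    using assms(1) by (auto simp: emeasure_density intro!: nn_integral_cong split: split_indicator)
qed

text \<open>Under any coupling the first coordinate lies in \<open>A\<close> almost surely, so
  wherever the second lies in \<open>B\<close> the integrand is at least
  \<open>\<delta> powr p\<close>. The bound is the same for all couplings and hence passes to the
  infimum.\<close>

lemma transport_cost_ge_separated:
  fixes \<mu> \<nu> :: "'a::euclidean_space measure"
  assumes A: "A \<in> sets borel" and B: "B \<in> sets borel"
    and null: "emeasure \<mu> (- A) = 0"
    and sep: "\<And>x y. x \<in> A \<Longrightarrow> y \<in> B \<Longrightarrow> \<delta> \<le> dist x y"
    and "0 \<le> \<delta>" "0 \<le> p"
  shows "ennreal (\<delta> powr p) * emeasure \<nu> B \<le> transport_cost p \<mu> \<nu>"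
  unfolding transport_cost_def
proof (rule INF_greatest)
  fix \<pi> :: "('a \<times> 'a) measure" assume "\<pi> \<in> couplings \<mu> \<nu>"
  then have sets: "sets \<pi> = sets (borel \<Otimes>\<^sub>M borel)"
    and \<mu>: "distr \<pi> borel fst = \<mu>" and \<nu>: "distr \<pi> borel snd = \<nu>"
    by (auto simp: couplings_def)
  have space: "space \<pi> = UNIV"
    using sets_eq_imp_space_eq[OF sets] by (simp add: space_pair_measure)
  have fst: "fst \<in> measurable \<pi> borel" and snd: "snd \<in> measurable \<pi> borel"
    by (simp_all add: measurable_cong_sets[OF sets refl])
  have mA: "fst -` (- A) \<in> sets \<pi>" and mB: "snd -` B \<in> sets \<pi>"
    using measurable_sets[OF fst, of "- A"] measurable_sets[OF snd, of B] A B
    by (auto simp: space)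
  have "emeasure \<pi> (fst -` (- A)) = 0"
    using null A unfolding \<mu>[symmetric] by (subst (asm) emeasure_distr[OF fst]) (auto simp: space)
  with mA have AE: "AE z in \<pi>. fst z \<in> A"
    by (intro AE_I[where N = "fst -` (- A)"]) auto
  have "emeasure \<nu> B = emeasure \<pi> (snd -` B)"
    using B unfolding \<nu>[symmetric] by (subst emeasure_distr[OF snd]) (auto simp: space)
  then have "ennreal (\<delta> powr p) * emeasure \<nu> B
      = (\<integral>\<^sup>+z. ennreal (\<delta> powr p) * indicator (snd -` B) z \<partial>\<pi>)"
    using mB by (simp add: nn_integral_cmult_indicator)
  also have "\<dots> \<le> (\<integral>\<^sup>+z. ennreal (norm (fst z - snd z) powr p) \<partial>\<pi>)"
  proof (rule nn_integral_mono_AE, use AE in eventually_elim)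
    fix z :: "'a \<times> 'a" assume "fst z \<in> A"
    then show "ennreal (\<delta> powr p) * indicator (snd -` B) z \<le> ennreal (norm (fst z - snd z) powr p)"
      using sep[of "fst z" "snd z"] \<open>0 \<le> \<delta>\<close> \<open>0 \<le> p\<close>
      by (auto simp: dist_norm intro!: ennreal_leI powr_mono2 split: split_indicator)
  qed
  finally show "ennreal (\<delta> powr p) * emeasure \<nu> B
      \<le> (\<integral>\<^sup>+z. ennreal (norm (fst z - snd z) powr p) \<partial>\<pi>)" .
qed

lemma wasserstein_ge_powr:
  assumes "ennreal c \<le> transport_cost p \<mu> \<nu>" and "0 \<le> c" "0 < p"
  shows "ennreal (c powr (1 / p)) \<le> wasserstein p \<mu> \<nu>"
proof (cases "transport_cost p \<mu> \<nu> = \<infinity>")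
  \<comment> \<open>\<open>enn2real\<close> sends infinity to 0, so comparison through it is sound
    only for finite cost.\<close>
  case False
  then have "c \<le> enn2real (transport_cost p \<mu> \<nu>)"
    using assms(1,2) by (cases "transport_cost p \<mu> \<nu>") auto
  with False assms show ?thesis
    by (auto simp: wasserstein_def intro!: ennreal_leI powr_mono2)
qed (simp add: wasserstein_def)

text \<open>If the common value were 0, both parts would vanish almost everywhere, and
  \<open>h\<close> with them. Equality lets one constant normalise both parts to densities.\<close>

lemma integral_pos_part_eq_neg_part:
  fixes h :: "'a \<Rightarrow> real"
  assumes h: "integrable M h" and zero: "(\<integral>x. h x \<partial>M) = 0" and nz: "\<not> (AE x in M. h x = 0)"
  shows "(\<integral>x. max 0 (- h x) \<partial>M) = (\<integral>x. max 0 (h x) \<partial>M)"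
    and "0 < (\<integral>x. max 0 (h x) \<partial>M)"
proof -
  have ip: "integrable M (\<lambda>x. max 0 (h x))" and im: "integrable M (\<lambda>x. max 0 (- h x))"
    using h by auto
  have "(\<integral>x. max 0 (h x) \<partial>M) - (\<integral>x. max 0 (- h x) \<partial>M) = (\<integral>x. h x \<partial>M)"
    unfolding Bochner_Integration.integral_diff[OF ip im, symmetric]
    by (intro Bochner_Integration.integral_cong refl) (simp add: max_def)
  with zero show eq: "(\<integral>x. max 0 (- h x) \<partial>M) = (\<integral>x. max 0 (h x) \<partial>M)"
    by simp
  have "(\<integral>x. max 0 (h x) \<partial>M) \<noteq> 0"
  proof
    assume "(\<integral>x. max 0 (h x) \<partial>M) = 0"
    with eq have "AE x in M. max 0 (h x) = 0" "AE x in M. max 0 (- h x) = 0"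
      using integral_nonneg_eq_0_iff_AE[OF ip] integral_nonneg_eq_0_iff_AE[OF im] by auto
    then have "AE x in M. h x = 0"
      by eventually_elim (auto simp: max_def split: if_splits)
    with nz show False ..
  qed
  moreover have "0 \<le> (\<integral>x. max 0 (h x) \<partial>M)"
    by (rule Bochner_Integration.integral_nonneg) auto
  ultimately show "0 < (\<integral>x. max 0 (h x) \<partial>M)"
    by linarith
qed

text \<open>The difference is controlled at every point, not just almost everywhere, because an
  extended norm need not identify functions that agree almost everywhere.\<close>

lemma wasserstein_mass_transfer:
  fixes \<Omega> :: "'a::euclidean_space set" and h :: "'a \<Rightarrow> real"
  assumes h: "h \<in> L1_on \<Omega>" and zero: "(\<integral>x. h x \<partial>lebesgue_on \<Omega>) = 0"
    and nz: "\<not> (AE x in lebesgue_on \<Omega>. h x = 0)"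
    and sep: "\<And>x y. x \<in> closure {x \<in> \<Omega>. h x > 0} \<Longrightarrow> y \<in> closure {x \<in> \<Omega>. h x < 0} \<Longrightarrow> \<delta> \<le> dist x y"
    and "0 \<le> \<delta>" "0 < p" "0 < \<epsilon>" "\<epsilon> \<le> 1"
    and m: "m = (\<integral>x. max 0 (h x) \<partial>lebesgue_on \<Omega>)"
  shows "\<exists>f g. f \<in> densities \<Omega> \<and> g \<in> densities \<Omega> \<and> (\<forall>x. f x - g x = \<epsilon> / m * h x) \<and>
    ennreal (\<delta> * \<epsilon> powr (1 / p)) \<le> wasserstein p (density_measure \<Omega> f) (density_measure \<Omega> g)"
proof -
  define f where "f x = max 0 (h x) / m" for x
  define k where "k x = max 0 (- h x) / m" for x
  define g where "g x = (1 - \<epsilon>) * f x + \<epsilon> * k x" for x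
  \<comment> \<open>Closures are Borel, whereas the sign sets of a Lebesgue measurable
    \<open>h\<close> need not be.\<close>
  define A where "A = closure {x \<in> \<Omega>. h x > 0}"
  define B where "B = closure {x \<in> \<Omega>. h x < 0}"
  have ih: "integrable (lebesgue_on \<Omega>) h"
    using h by (simp add: L1_on_def)
  have mk: "(\<integral>x. max 0 (- h x) \<partial>lebesgue_on \<Omega>) = m" and "0 < m"
    using integral_pos_part_eq_neg_part[OF ih zero nz] m by auto
  have if_: "integrable (lebesgue_on \<Omega>) f" and ik: "integrable (lebesgue_on \<Omega>) k"
    unfolding f_def k_def using ih by auto
  have ig: "integrable (lebesgue_on \<Omega>) g"
    unfolding g_def using if_ ik by auto
  have f1: "(\<integral>x. f x \<partial>lebesgue_on \<Omega>) = 1" and k1: "(\<integral>x. k x \<partial>lebesgue_on \<Omega>) = 1"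
    using \<open>0 < m\<close> mk m by (simp_all add: f_def k_def)
  have f0: "0 \<le> f x" and k0: "0 \<le> k x" for x
    using \<open>0 < m\<close> by (simp_all add: f_def k_def)
  have g0: "0 \<le> g x" and g_ge: "\<epsilon> * k x \<le> g x" for x
    using f0[of x] k0[of x] \<open>0 < \<epsilon>\<close> \<open>\<epsilon> \<le> 1\<close> by (simp_all add: g_def)
  have g1: "(\<integral>x. g x \<partial>lebesgue_on \<Omega>) = 1"
    unfolding g_def using if_ ik f1 k1 by simp
  have dens: "f \<in> densities \<Omega>" "g \<in> densities \<Omega>"
    using if_ ig f1 g1 f0 g0 by (auto simp: densities_def L1_on_def)
  \<comment> \<open>\<open>f - g\<close> equals \<open>\<epsilon> * (f - k)\<close>, and positive
    part minus negative part is \<open>h\<close>.\<close>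
  have diff: "f x - g x = \<epsilon> / m * h x" for x
    using \<open>0 < m\<close> by (auto simp: g_def f_def k_def field_simps max_def)
  have "emeasure (density_measure \<Omega> f) (- A)
      = (\<integral>\<^sup>+x. ennreal (f x) * indicator (- A) x \<partial>lebesgue_on \<Omega>)"
    using if_ by (intro emeasure_density_measure) (auto simp: A_def)
  also have "\<dots> = (\<integral>\<^sup>+x. 0 \<partial>lebesgue_on \<Omega>)"
  proof (rule nn_integral_cong)
    fix x assume "x \<in> space (lebesgue_on \<Omega>)"
    then have "x \<in> A" if "0 < h x"
      using that closure_subset[of "{x \<in> \<Omega>. h x > 0}"] by (auto simp: A_def)
    then show "ennreal (f x) * indicator (- A) x = 0"
      by (cases "0 < h x") (auto simp: f_def max_def)
  qed
  finally have null: "emeasure (density_measure \<Omega> f) (- A) = 0"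
    by simp
  \<comment> \<open>The summand \<open>\<epsilon> * k\<close> of \<open>g\<close> has mass
    \<open>\<epsilon>\<close> and vanishes off \<open>B\<close>; the other summand is
    nonnegative.\<close>
  have "ennreal \<epsilon> = (\<integral>\<^sup>+x. ennreal (\<epsilon> * k x) \<partial>lebesgue_on \<Omega>)"
    using ik k1 k0 \<open>0 < \<epsilon>\<close> by (subst nn_integral_eq_integral) auto
  also have "\<dots> \<le> (\<integral>\<^sup>+x. ennreal (g x) * indicator B x \<partial>lebesgue_on \<Omega>)"
  proof (rule nn_integral_mono)
    fix x assume "x \<in> space (lebesgue_on \<Omega>)"
    then have "x \<in> B" if "h x < 0"
      using that closure_subset[of "{x \<in> \<Omega>. h x < 0}"] by (auto simp: B_def)
    then show "ennreal (\<epsilon> * k x) \<le> ennreal (g x) * indicator B x"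
      using g_ge[of x] by (cases "h x < 0") (auto simp: k_def max_def intro: ennreal_leI)
  qed
  also have "\<dots> = emeasure (density_measure \<Omega> g) B"
    using ig by (intro emeasure_density_measure[symmetric]) (auto simp: B_def)
  finally have mass: "ennreal \<epsilon> \<le> emeasure (density_measure \<Omega> g) B" .
  have "ennreal (\<delta> powr p * \<epsilon>) = ennreal (\<delta> powr p) * ennreal \<epsilon>"
    by (simp add: ennreal_mult')
  also have "\<dots> \<le> ennreal (\<delta> powr p) * emeasure (density_measure \<Omega> g) B"
    using mass by (rule mult_left_mono) simp
  also have "\<dots> \<le> transport_cost p (density_measure \<Omega> f) (density_measure \<Omega> g)"
    using null sep \<open>0 \<le> \<delta>\<close> \<open>0 < p\<close>
    by (intro transport_cost_ge_separated[where A = A]) (auto simp: A_def B_def)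
  finally have "ennreal ((\<delta> powr p * \<epsilon>) powr (1 / p))
      \<le> wasserstein p (density_measure \<Omega> f) (density_measure \<Omega> g)"
    using \<open>0 < \<epsilon>\<close> \<open>0 < p\<close> by (intro wasserstein_ge_powr) auto
  moreover have "(\<delta> powr p * \<epsilon>) powr (1 / p) = \<delta> * \<epsilon> powr (1 / p)"
    using \<open>0 \<le> \<delta>\<close> \<open>0 < \<epsilon>\<close> \<open>0 < p\<close> by (simp add: powr_mult powr_powr)
  ultimately show ?thesis
    using dens diff by auto
qed

lemma powr_unbounded_near_zero:
  fixes c K p :: real
  assumes "0 < c" "1 < p"
  shows "\<exists>\<epsilon>. 0 < \<epsilon> \<and> \<epsilon> \<le> 1 \<and> K < c * \<epsilon> powr (1 / p) / \<epsilon>"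
proof -
  \<comment> \<open>The summand 1 makes \<open>K < c / t\<close> strict and the denominator
    positive; the minimum with 1 ensures \<open>\<epsilon> \<le> 1\<close>.\<close>
  define t where "t = min 1 (c / (\<bar>K\<bar> + 1))"
  \<comment> \<open>The exponent is the reciprocal of \<open>1 - 1 / p\<close>, so that
    \<open>\<epsilon> powr (1 / p - 1)\<close> is exactly \<open>1 / t\<close>.\<close>
  define \<epsilon> where "\<epsilon> = t powr (p / (p - 1))"
  have t: "0 < t" "t \<le> 1" "t \<le> c / (\<bar>K\<bar> + 1)"
    using assms(1) by (auto simp: t_def)
  have "\<epsilon> powr (1 / p) / \<epsilon> = \<epsilon> powr (1 / p - 1)"
    using t by (simp add: powr_diff \<epsilon>_def)
  also have "\<dots> = t powr (p / (p - 1) * (1 / p - 1))"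
    by (simp add: \<epsilon>_def powr_powr)
  also have "p / (p - 1) * (1 / p - 1) = - 1"
    using assms(2) by (simp add: divide_simps)
  finally have "\<epsilon> powr (1 / p) / \<epsilon> = 1 / t"
    using t by (simp add: powr_minus divide_inverse)
  moreover have "K < c / t"
  proof -
    have "t * (\<bar>K\<bar> + 1) \<le> c"
      using t(3) by (simp add: pos_le_divide_eq)
    then have "\<bar>K\<bar> + 1 \<le> c / t"
      using t(1) by (simp add: pos_le_divide_eq mult.commute)
    then show ?thesis by linarith
  qed
  moreover have "0 < \<epsilon>" "\<epsilon> \<le> 1"
    using t assms(2) by (auto simp: \<epsilon>_def intro!: powr_le1)
  ultimately have "0 < \<epsilon> \<and> \<epsilon> \<le> 1 \<and> K < c * (\<epsilon> powr (1 / p) / \<epsilon>)"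
    by simp
  then show ?thesis
    unfolding times_divide_eq_right by blast
qed

lemma bounded_unit_cube: "bounded (unit_cube :: (real ^ 'n) set)"
proof -
  have cube: "unit_cube = cbox (0 :: real ^ 'n) 1"
    by (auto simp: unit_cube_def mem_box_cart)
  show ?thesis unfolding cube by (rule bounded_cbox)
qed

theorem theorem9:
  fixes N :: "((real ^ 'n) \<Rightarrow> real) \<Rightarrow> ennreal" and p :: real
  assumes "extended_norm_on unit_cube N"
    and "\<exists>h \<in> L1_on (unit_cube :: (real ^ 'n) set).
           \<not> (AE x in lebesgue_on unit_cube. h x = 0) \<and>
           (\<integral>x. h x \<partial>lebesgue_on unit_cube) = 0 \<and>
           N h < \<infinity> \<and>
           closure {x \<in> unit_cube. h x > 0} \<inter> closure {x \<in> unit_cube. h x < 0} = {}"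
    and "1 < p"
  shows "(SUP (f, g) \<in> {(f, g). f \<in> densities (unit_cube :: (real ^ 'n) set) \<and>
                                g \<in> densities unit_cube \<and>
                                \<not> (AE x in lebesgue_on unit_cube. f x = g x)}.
            wasserstein p (density_measure unit_cube f) (density_measure unit_cube g)
              / N (\<lambda>x. f x - g x)) = \<infinity>"
proof -
  let ?\<Omega> = "unit_cube :: (real ^ 'n) set"
  let ?W = "\<lambda>f g. wasserstein p (density_measure ?\<Omega> f) (density_measure ?\<Omega> g)"
  from assms(2) obtain h where h: "h \<in> L1_on ?\<Omega>"
    and nz: "\<not> (AE x in lebesgue_on ?\<Omega>. h x = 0)"
    and zero: "(\<integral>x. h x \<partial>lebesgue_on ?\<Omega>) = 0" and fin: "N h < \<infinity>"
    and disj: "closure {x \<in> ?\<Omega>. h x > 0} \<inter> closure {x \<in> ?\<Omega>. h x < 0} = {}"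
    by auto
  \<comment> \<open>Disjoint closed sets may be at distance 0; compactness of one of them yields a
    positive \<open>\<delta>\<close>.\<close>
  have "bounded {x \<in> ?\<Omega>. h x > 0}"
    using bounded_unit_cube by (rule bounded_subset) auto
  then have "compact (closure {x \<in> ?\<Omega>. h x > 0})"
    by simp
  from separate_compact_closed[OF this closed_closure disj]
  obtain \<delta> where "0 < \<delta>" and sep: "\<And>x y. x \<in> closure {x \<in> ?\<Omega>. h x > 0} \<Longrightarrow>
      y \<in> closure {x \<in> ?\<Omega>. h x < 0} \<Longrightarrow> \<delta> \<le> dist x y"
    by blast
  define m where "m = (\<integral>x. max 0 (h x) \<partial>lebesgue_on ?\<Omega>)"
  have "0 < m"
    unfolding m_def using h zero nz by (intro integral_pos_part_eq_neg_part) (auto simp: L1_on_def)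
  define n where "n = enn2real (N h)"
  have Nh: "N h = ennreal n"
    using fin by (simp add: n_def)
  \<comment> \<open>Definiteness up to null sets suffices, since \<open>h\<close> is not zero almost
    everywhere.\<close>
  have "N h \<noteq> 0"
    using assms(1) h nz unfolding extended_norm_on_def by blast
  then have "0 < n"
    using Nh by (cases "0 < n") (auto simp: ennreal_neg)
  \<comment> \<open>A supremum in \<open>ennreal\<close> is infinite iff every finite
    \<open>y\<close> is exceeded by some member.\<close>
  have "\<exists>i\<in>{(f, g). f \<in> densities ?\<Omega> \<and> g \<in> densities ?\<Omega> \<and>
        \<not> (AE x in lebesgue_on ?\<Omega>. f x = g x)}.
      y < (case i of (f, g) \<Rightarrow> ?W f g / N (\<lambda>x. f x - g x))" if "y < top" for y :: ennreal
  proof -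
    obtain K where K: "0 \<le> K" "y = ennreal K"
      using \<open>y < top\<close> by (cases y) auto
    \<comment> \<open>The right-hand side is the lower bound
      \<open>\<delta> * \<epsilon> powr (1 / p)\<close> for the distance divided by the norm
      \<open>\<epsilon> / m * n\<close> of the difference.\<close>
    obtain \<epsilon> where \<epsilon>: "0 < \<epsilon>" "\<epsilon> \<le> 1" "K < \<delta> * m / n * \<epsilon> powr (1 / p) / \<epsilon>"
      using powr_unbounded_near_zero[of "\<delta> * m / n" p K] \<open>0 < \<delta>\<close> \<open>0 < m\<close> \<open>0 < n\<close> \<open>1 < p\<close> by auto
    obtain f g where fg: "f \<in> densities ?\<Omega>" "g \<in> densities ?\<Omega>"
      and diff: "\<And>x. f x - g x = \<epsilon> / m * h x"
      and W: "ennreal (\<delta> * \<epsilon> powr (1 / p)) \<le> ?W f g"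
      using wasserstein_mass_transfer[OF h zero nz sep _ _ \<epsilon>(1,2) m_def, of p] \<open>0 < \<delta>\<close> \<open>1 < p\<close>
      by force
    have "f x = g x \<longleftrightarrow> h x = 0" for x
      using diff[of x] \<open>0 < \<epsilon>\<close> \<open>0 < m\<close> by (metis divide_eq_0_iff less_irrefl
          mult_eq_0_iff right_minus_eq)
    then have ne: "\<not> (AE x in lebesgue_on ?\<Omega>. f x = g x)"
      using nz by simp
    \<comment> \<open>The pointwise identity rewrites the argument of \<open>N\<close> itself, after
      which homogeneity applies.\<close>
    have "N (\<lambda>x. f x - g x) = ennreal \<bar>\<epsilon> / m\<bar> * N h"
      unfolding diff using assms(1) h unfolding extended_norm_on_def by blast
    also have "\<dots> = ennreal (\<epsilon> / m * n)"
      using \<open>0 < \<epsilon>\<close> \<open>0 < m\<close> \<open>0 < n\<close>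
      unfolding Nh by (subst ennreal_mult'[symmetric]) auto
    finally have N: "N (\<lambda>x. f x - g x) = ennreal (\<epsilon> / m * n)" .
    have "K < \<delta> * \<epsilon> powr (1 / p) / (\<epsilon> / m * n)"
      using \<epsilon>(3) by (simp add: field_simps)
    then have "y < ennreal (\<delta> * \<epsilon> powr (1 / p) / (\<epsilon> / m * n))"
      using K by (simp add: ennreal_less_iff)
    also have "\<dots> = ennreal (\<delta> * \<epsilon> powr (1 / p)) / N (\<lambda>x. f x - g x)"
      unfolding N using \<open>0 < \<delta>\<close> \<open>0 < \<epsilon>\<close> \<open>0 < m\<close> \<open>0 < n\<close> by (intro divide_ennreal[symmetric]) auto
    also have "\<dots> \<le> ?W f g / N (\<lambda>x. f x - g x)"
      using W by (rule divide_right_mono_ennreal)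
    finally show ?thesis
      using fg ne by auto
  qed
  then show ?thesis
    unfolding infinity_ennreal_def SUP_eq_top_iff by blast
qed

end
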